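(* Let $\mathcal{K}^{\langle 0\rangle}$ be a simple nested fractal in $\mathbb{R}^2$ with $k=6$ essential fixed points, and suppose that some $0$-complex $\Delta_0\subset\mathcal{K}^{\langle 1\rangle}$ has its barycenter at the barycenter of $\mathcal{K}^{\langle 1\rangle}$, i.e. $\mathcal{B}_{\Delta_0}=\mathcal{B}_{\mathcal{K}^{\langle 1\rangle}}$. Then the corresponding unbounded simple nested fractal $\mathcal{K}^{\langle\infty\rangle}$ does not have the good labelling property (GLP).
   Context: Simple nested fractal (SNF). Let $\Psi_i:\mathbb{R}^2\to\mathbb{R}^2$, $\Psi_i(x)=x/L+\nu_i$, $i=1,\dots,N$, with $L>1$, $\nu_i\in\mathbb{R}^2$, and one of the $\nu_i$ equal to $0$. $\mathcal{K}^{\langle 0\rangle}$ is the unique nonempty compact set with $\mathcal{K}^{\langle 0\rangle}=\bigcup_{i=1}^N\Psi_i(\mathcal{K}^{\langle 0\rangle})$. Let $F$ be the set of fixed points of the $\Psi_i$. A point $x\in F$ is an essential fixed point if there are another fixed point $y\in F$ and two different maps $\Psi_i,\Psi_j$ with $\Psi_i(x)=\Psi_j(y)$. $V_0^{\langle 0\rangle}$ is the set of essential fixed points and $k=\#V_0^{\langle 0\rangle}$. $\mathcal{K}^{\langle 0\rangle}$ is an SNF if: (1) $k\ge 2$; (2) (Open Set Condition) there is an open $U\subset\mathbb{R}^2$ with $\Psi_i(U)\cap\Psi_j(U)=\emptyset$ for $i\ne j$ and $\bigcup_i\Psi_i(U)\subseteq U$; (3) (Nesting) $\Psi_i(\mathcal{K}^{\langle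 0\rangle})\cap\Psi_j(\mathcal{K}^{\langle 0\rangle})=\Psi_i(V_0^{\langle 0\rangle})\cap\Psi_j(V_0^{\langle 0\rangle})$ for $i\neq j$; (4) (Symmetry) for $x,y\in V_0^{\langle 0\rangle}$ let $S_{x,y}$ be the reflection in the line perpendicularly bisecting $[x,y]$; for all $i\in\{1,\dots,N\}$ and all $x,y\in V_0^{\langle 0\rangle}$ there is $j\in\{1,\dots,N\}$ with $S_{x,y}(\Psi_i(V_0^{\langle 0\rangle}))=\Psi_j(V_0^{\langle 0\rangle})$; (5) (Connectivity) the graph on $V_{-1}^{\langle 0\rangle}=\bigcup_i\Psi_i(V_0^{\langle 0\rangle})$ in which $x,y$ are joined iff $x,y\in\Psi_i(\mathcal{K}^{\langle 0\rangle})$ for some $i$ is connected. For $k\ge 3$ it is known that $V_0^{\langle 0\rangle}$ is the vertex set of a regular $k$-gon. Complexes. $\mathcal{K}^{\langle M\rangle}=L^M\mathcal{K}^{\langle 0\rangle}$ and $\mathcal{K}^{\langle\infty\rangle}=\bigcup_{M\ge 0}\mathcal{K}^{\langle M\rangle}$ (the unbounded SNF). A $0$-complex is a set $\Delta_0=\mathcal{K}^{\langle 0\rangle}+\nu_{\Delta_0}\subset\mathcal{K}^{\langle\infty\rangle}$ with $\nu_{\Delta_0}=\sum_{j=1}^{J}L^j\nu_{i_j}$, $J\ge 1$, $\nu_{i_j}\in\{\nu_1,\dots,\nu_N\}$; its vertex set is $V(\Delta_0)=V_0^{\langle 0\rangle}+\nu_{\Delta_0}$. The $0$-complexes in $\mathcal{K}^{\langle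 1\rangle}$ are the sets $\mathcal{K}^{\langle 0\rangle}+L\nu_i$, $i=1,\dots,N$. $V_0^{\langle\infty\rangle}$ is the set of vertices of all $0$-complexes. $\mathcal{B}_{\Delta_0}$ and $\mathcal{B}_{\mathcal{K}^{\langle 1\rangle}}$ denote the barycenters of $\Delta_0$ and $\mathcal{K}^{\langle 1\rangle}$ (the centers of the regular $k$-gons spanned by $V(\Delta_0)$ and by $LV_0^{\langle 0\rangle}$). GLP. Let $\mathcal{A}$ be a set of $k$ labels, and let $\mathcal{R}_0$ be the set of the $k$ rotations around the barycenter of $\mathcal{K}^{\langle 0\rangle}$ mapping $V_0^{\langle 0\rangle}$ onto itself. $\mathcal{K}^{\langle\infty\rangle}$ has the GLP if there is $\ell:V_0^{\langle\infty\rangle}\to\mathcal{A}$ whose restriction to $V_0^{\langle 0\rangle}$ is a bijection onto $\mathcal{A}$ and such that for every $0$-complex $\Delta_0=\mathcal{K}^{\langle 0\rangle}+\nu_{\Delta_0}$ there is $R_{\Delta_0}\in\mathcal{R}_0$ with $\ell(v)=\ell(R_{\Delta_0}(v-\nu_{\Delta_0}))$ for all $v\in V(\Delta_0)$. (By self-similarity the analogous property for complexes of any other scale $L^M$, $M\in\mathbb{Z}$, is equivalent.) *)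

theory Defs
  imports "HOL-Analysis.Analysis"
begin

type_synonym plane = "real ^ 2"

text \<open>
  Throughout, \<open>N\<close>, \<open>L\<close> and \<open>\<nu>\<close> are the data of the iterated function system
  (only the values \<open>\<nu> 1, \<dots>, \<nu> N\<close> are used) and \<open>K\<close> is its attractor.
\<close>

definition Psi :: "real \<Rightarrow> (nat \<Rightarrow> plane) \<Rightarrow> nat \<Rightarrow> plane \<Rightarrow> plane" where
  "Psi L \<nu> i x = x /\<^sub>R L + \<nu> i"

definition attractor :: "nat \<Rightarrow> real \<Rightarrow> (nat \<Rightarrow> plane) \<Rightarrow> plane set \<Rightarrow> bool" where
  "attractor N L \<nu> K \<longleftrightarrow>
     compact K \<and> K \<noteq> {} \<and> K = (\<Union>i\<in>{1..N}. Psi L \<nu> i ` K)"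

definition fixed_points :: "nat \<Rightarrow> real \<Rightarrow> (nat \<Rightarrow> plane) \<Rightarrow> plane set" where
  "fixed_points N L \<nu> = {x. \<exists>i\<in>{1..N}. Psi L \<nu> i x = x}"

definition essential_fixed_points :: "nat \<Rightarrow> real \<Rightarrow> (nat \<Rightarrow> plane) \<Rightarrow> plane set" where
  "essential_fixed_points N L \<nu> =
     {x \<in> fixed_points N L \<nu>.
        \<exists>y\<in>fixed_points N L \<nu>. y \<noteq> x \<and>
          (\<exists>i\<in>{1..N}. \<exists>j\<in>{1..N}. Psi L \<nu> i \<noteq> Psi L \<nu> j \<and> Psi L \<nu> i x = Psi L \<nu> j y)}"

definition open_set_condition :: "nat \<Rightarrow> real \<Rightarrow> (nat \<Rightarrow> plane) \<Rightarrow> bool" where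
  "open_set_condition N L \<nu> \<longleftrightarrow>
     (\<exists>U. open U \<and> U \<noteq> {} \<and>
        (\<forall>i\<in>{1..N}. \<forall>j\<in>{1..N}. i \<noteq> j \<longrightarrow> Psi L \<nu> i ` U \<inter> Psi L \<nu> j ` U = {}) \<and>
        (\<Union>i\<in>{1..N}. Psi L \<nu> i ` U) \<subseteq> U)"

definition nesting :: "nat \<Rightarrow> real \<Rightarrow> (nat \<Rightarrow> plane) \<Rightarrow> plane set \<Rightarrow> bool" where
  "nesting N L \<nu> K \<longleftrightarrow>
     (\<forall>i\<in>{1..N}. \<forall>j\<in>{1..N}. i \<noteq> j \<longrightarrow>
        Psi L \<nu> i ` K \<inter> Psi L \<nu> j ` K =
        Psi L \<nu> i ` essential_fixed_points N L \<nu> \<inter> Psi L \<nu> j ` essential_fixed_points N L \<nu>)"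

definition bisector_reflection :: "plane \<Rightarrow> plane \<Rightarrow> plane \<Rightarrow> plane" where
  "bisector_reflection x y z =
     z - (2 * ((z - midpoint x y) \<bullet> (y - x)) / ((y - x) \<bullet> (y - x))) *\<^sub>R (y - x)"

definition reflection_symmetry :: "nat \<Rightarrow> real \<Rightarrow> (nat \<Rightarrow> plane) \<Rightarrow> bool" where
  "reflection_symmetry N L \<nu> \<longleftrightarrow>
     (\<forall>i\<in>{1..N}. \<forall>x\<in>essential_fixed_points N L \<nu>. \<forall>y\<in>essential_fixed_points N L \<nu>.
        x \<noteq> y \<longrightarrow>
        (\<exists>j\<in>{1..N}. bisector_reflection x y ` Psi L \<nu> i ` essential_fixed_points N L \<nu> =
                     Psi L \<nu> j ` essential_fixed_points N L \<nu>))"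

definition connectivity :: "nat \<Rightarrow> real \<Rightarrow> (nat \<Rightarrow> plane) \<Rightarrow> plane set \<Rightarrow> bool" where
  "connectivity N L \<nu> K \<longleftrightarrow>
     (let V = (\<Union>i\<in>{1..N}. Psi L \<nu> i ` essential_fixed_points N L \<nu>);
          E = {(x, y). x \<in> V \<and> y \<in> V \<and>
                 (\<exists>i\<in>{1..N}. x \<in> Psi L \<nu> i ` K \<and> y \<in> Psi L \<nu> i ` K)}
      in \<forall>x\<in>V. \<forall>y\<in>V. (x, y) \<in> E\<^sup>*)"

definition simple_nested_fractal :: "nat \<Rightarrow> real \<Rightarrow> (nat \<Rightarrow> plane) \<Rightarrow> plane set \<Rightarrow> bool" where
  "simple_nested_fractal N L \<nu> K \<longleftrightarrow>
     L > 1 \<and> (\<exists>i\<in>{1..N}. \<nu> i = 0) \<and> attractor N L \<nu> K \<and>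
     card (essential_fixed_points N L \<nu>) \<ge> 2 \<and>
     open_set_condition N L \<nu> \<and>
     nesting N L \<nu> K \<and>
     reflection_symmetry N L \<nu> \<and>
     connectivity N L \<nu> K"

definition scaled_fractal :: "real \<Rightarrow> plane set \<Rightarrow> nat \<Rightarrow> plane set" where
  "scaled_fractal L K M = (\<lambda>x. L ^ M *\<^sub>R x) ` K"

definition unbounded_fractal :: "real \<Rightarrow> plane set \<Rightarrow> plane set" where
  "unbounded_fractal L K = (\<Union>M. scaled_fractal L K M)"

text \<open>
  A \<open>0\<close>-complex \<open>K + t\<close> is represented by its translation vector \<open>t\<close>, which the set
  \<open>K + t\<close> determines because \<open>K\<close> is nonempty and bounded.
\<close>

definition zero_complex_shifts :: "nat \<Rightarrow> real \<Rightarrow> (nat \<Rightarrow> plane) \<Rightarrow> plane set \<Rightarrow> plane set" where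
  "zero_complex_shifts N L \<nu> K =
     {t. (\<exists>J::nat. \<exists>w::nat \<Rightarrow> nat. J \<ge> 1 \<and> (\<forall>j\<in>{1..J}. w j \<in> {1..N}) \<and>
            t = (\<Sum>j=1..J. L ^ j *\<^sub>R \<nu> (w j))) \<and>
         (+) t ` K \<subseteq> unbounded_fractal L K}"

definition complex_vertices :: "nat \<Rightarrow> real \<Rightarrow> (nat \<Rightarrow> plane) \<Rightarrow> plane \<Rightarrow> plane set" where
  "complex_vertices N L \<nu> t = (+) t ` essential_fixed_points N L \<nu>"

definition all_vertices :: "nat \<Rightarrow> real \<Rightarrow> (nat \<Rightarrow> plane) \<Rightarrow> plane set \<Rightarrow> plane set" where
  "all_vertices N L \<nu> K = (\<Union>t\<in>zero_complex_shifts N L \<nu> K. complex_vertices N L \<nu> t)"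

text \<open>
  The barycenter of a complex is the arithmetic mean of its finitely many vertices; if these
  span a regular polygon, it is the center of that polygon.
\<close>

definition barycenter :: "plane set \<Rightarrow> plane" where
  "barycenter V = (\<Sum>v\<in>V. v) /\<^sub>R real (card V)"

definition vertex_rotations :: "nat \<Rightarrow> real \<Rightarrow> (nat \<Rightarrow> plane) \<Rightarrow> (plane \<Rightarrow> plane) set" where
  "vertex_rotations N L \<nu> =
     (let V = essential_fixed_points N L \<nu>; b = barycenter V
      in {R. \<exists>Q :: real ^ 2 ^ 2. rotation_matrix Q \<and> R = (\<lambda>x. b + Q *v (x - b)) \<and> R ` V = V})"

definition good_labelling ::
    "'a set \<Rightarrow> nat \<Rightarrow> real \<Rightarrow> (nat \<Rightarrow> plane) \<Rightarrow> plane set \<Rightarrow> (plane \<Rightarrow> 'a) \<Rightarrow> bool" where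
  "good_labelling A N L \<nu> K l \<longleftrightarrow>
     l ` all_vertices N L \<nu> K \<subseteq> A \<and>
     bij_betw l (essential_fixed_points N L \<nu>) A \<and>
     (\<forall>t\<in>zero_complex_shifts N L \<nu> K. \<exists>R\<in>vertex_rotations N L \<nu>.
        \<forall>v\<in>complex_vertices N L \<nu> t. l v = l (R (v - t)))"

definition has_GLP :: "'a set \<Rightarrow> nat \<Rightarrow> real \<Rightarrow> (nat \<Rightarrow> plane) \<Rightarrow> plane set \<Rightarrow> bool" where
  "has_GLP A N L \<nu> K \<longleftrightarrow> (\<exists>l. good_labelling A N L \<nu> K l)"

end

theory Submission
  imports Defs
begin

text \<open>
  The symmetry condition makes the six essential fixed points a regular hexagon, so that in
  complex coordinates about its center a rotation of labels is multiplication by some \<open>q\<close>.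
  A vertex common to two cells relates their factors, and central symmetry of the hexagon doubles
  every such relation. For two cells sharing a vertex this forces their centers to differ by
  twice a vertex vector \<open>x\<close>, and their factors to be opposite. Connectivity gives the central
  cell a neighbour at \<open>2x\<close>, and a reflection turns it into a neighbour at \<open>2\<omega>x\<close>, where \<open>\<omega>\<close> is
  a primitive sixth root of unity. Since \<open>\<omega> - 1 = \<omega>\<^sup>2\<close>, these two cells also share a vertex,
  and the three sign changes around the triangle are inconsistent.
\<close>

subsection \<open>Reflections in complex coordinates\<close>

definition to_complex :: "plane \<Rightarrow> complex" where
  "to_complex v = Complex (v $ 1) (v $ 2)"

lemma to_complex_add: "to_complex (v + w) = to_complex v + to_complex w"
  and to_complex_diff: "to_complex (v - w) = to_complex v - to_complex w"
  and to_complex_scaleR: "to_complex (a *\<^sub>R v) = of_real a * to_complex v"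
  and to_complex_0 [simp]: "to_complex 0 = 0"
  by (auto simp: to_complex_def complex_eq_iff)

lemma to_complex_eq_iff [simp]: "to_complex v = to_complex w \<longleftrightarrow> v = w"
  by (auto simp: to_complex_def vec_eq_iff forall_2)

lemma to_complex_eq_0_iff [simp]: "to_complex v = 0 \<longleftrightarrow> v = 0"
  using to_complex_eq_iff[of v 0] by simp

lemma to_complex_point_reflection:
  "to_complex (2 *\<^sub>R b - v - b) = - to_complex (v - b)"
  by (simp add: to_complex_def complex_eq_iff)

lemma inner_eq_Re_to_complex: "v \<bullet> w = Re (to_complex v * cnj (to_complex w))"
  by (simp add: to_complex_def inner_vec_def sum_2)

lemma norm_to_complex [simp]: "norm (to_complex v) = norm v"
  by (simp add: to_complex_def norm_vec_def L2_set_def cmod_def sum_2)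

lemma rotation_matrix_to_complex:
  fixes Q :: "real ^ 2 ^ 2"
  assumes "rotation_matrix Q"
  obtains q where "q \<noteq> 0" "\<And>v. to_complex (Q *v v) = q * to_complex v"
proof -
  let ?a = "Q $ 1 $ 1" and ?b = "Q $ 1 $ 2" and ?c = "Q $ 2 $ 1" and ?d = "Q $ 2 $ 2"
  have det: "?a * ?d - ?b * ?c = 1"
    using assms by (simp add: rotation_matrix_def det_2)
  have "transpose Q ** Q = mat 1"
    using assms by (simp add: rotation_matrix_def orthogonal_matrix_def)
  then have col: "?a * ?a + ?c * ?c = 1" "?b * ?b + ?d * ?d = 1"
    by (auto simp: vec_eq_iff forall_2 matrix_matrix_mult_def transpose_def mat_def sum_2)
  \<comment> \<open>The left side expands to the two squared column norms minus twice the
    determinant, \<open>1 + 1 - 2\<close>. Its vanishing puts \<open>Q\<close> in Cauchy-Riemann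
    form.\<close>
  have "(?a - ?d)\<^sup>2 + (?b + ?c)\<^sup>2 = 0"
    using det col by (simp add: power2_eq_square algebra_simps)
  then have "?a = ?d" "?b = - ?c"
    by (auto simp: sum_power2_eq_zero_iff)
  then have "to_complex (Q *v v) = Complex ?a ?c * to_complex v" for v
    by (simp add: to_complex_def complex_eq_iff matrix_vector_mult_def sum_2)
  moreover have "Complex ?a ?c \<noteq> 0"
    using col by (auto simp: complex_eq_iff)
  ultimately show ?thesis
    using that by blast
qed

text \<open>The linear part of \<open>bisector_reflection\<close>; for \<open>e = 0\<close> it
  degenerates to the identity, still a linear involution.\<close>

definition linear_reflection :: "plane \<Rightarrow> plane \<Rightarrow> plane" where
  "linear_reflection e z = z - (2 * (z \<bullet> e) / (e \<bullet> e)) *\<^sub>R e"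

lemma linear_linear_reflection: "linear (linear_reflection e)"
  by (rule linearI) (simp_all add: linear_reflection_def inner_add_left add_divide_distrib
      algebra_simps)

lemma linear_reflection_involution: "linear_reflection e (linear_reflection e z) = z"
  by (cases "e = 0") (simp_all add: linear_reflection_def inner_diff_left algebra_simps)

lemma inj_linear_reflection: "inj (linear_reflection e)"
  by (metis injI linear_reflection_involution)

lemma bisector_reflection_affine:
  "bisector_reflection x y z = linear_reflection (y - x) z + bisector_reflection x y 0"
proof -
  define e where "e = y - x"
  show ?thesis
    unfolding bisector_reflection_def linear_reflection_def e_def[symmetric]
    by (simp add: inner_diff_left right_diff_distrib diff_divide_distrib scaleR_diff_left)
qed

lemma inj_bisector_reflection: "inj (bisector_reflection x y)"
proof (rule injI)
  fix a b assume "bisector_reflection x y a = bisector_reflection x y b"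
  then have "linear_reflection (y - x) a = linear_reflection (y - x) b"
    using bisector_reflection_affine[of x y a] bisector_reflection_affine[of x y b] by simp
  then show "a = b"
    by (simp add: inj_eq[OF inj_linear_reflection])
qed

text \<open>A fixed \<open>c\<close> has its offset from the midpoint orthogonal to
  \<open>y - x\<close>, and that inner product is half the difference of the two squared
  distances.\<close>

lemma bisector_reflection_fixed_imp_equidistant:
  assumes "bisector_reflection x y c = c"
  shows "norm (x - c) = norm (y - c)"
proof (cases "x = y")
  case False
  then have "(c - midpoint x y) \<bullet> (y - x) = 0"
    using assms by (simp add: bisector_reflection_def)
  moreover have "(c - midpoint x y) \<bullet> (y - x) =
      ((x - c) \<bullet> (x - c) - (y - c) \<bullet> (y - c)) / 2"
    by (simp add: midpoint_def inner_simps inner_commute field_simps)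
  ultimately show ?thesis
    by (simp add: norm_eq_sqrt_inner)
qed simp

text \<open>About a center on its axis a reflection is conjugate-linear, and sending
  \<open>x\<close> to \<open>y\<close> determines the factor. On the circle through \<open>x\<close>
  and \<open>y\<close> the conjugate is an inverse up to scale, so reflecting becomes the
  multiplicative rule \<open>x * y / z\<close>.\<close>

lemma to_complex_bisector_reflection:
  fixes x y z c :: plane
  assumes eq: "norm (x - c) = norm (y - c)" and "x \<noteq> y"
  shows "to_complex (bisector_reflection x y z - c) =
    to_complex (x - c) * to_complex (y - c) * cnj (to_complex (z - c)) / (norm (x - c))\<^sup>2"
proof -
  define X Y Z r where "X = to_complex (x - c)" "Y = to_complex (y - c)"
    "Z = to_complex (z - c)" "r = complex_of_real (norm (x - c))"
  note defs = this
  define e where "e = Y - X"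
  have e: "to_complex (y - x) = e" and "e \<noteq> 0"
    using \<open>x \<noteq> y\<close> by (auto simp: e_def defs to_complex_diff)
  have XX: "X * cnj X = r\<^sup>2" and YY: "Y * cnj Y = r\<^sup>2"
    using eq by (simp_all add: defs complex_norm_square[symmetric])
  have "(z - midpoint x y) \<bullet> (y - x) = (z - c) \<bullet> (y - x)
      + ((x - c) \<bullet> (x - c) - (y - c) \<bullet> (y - c)) / 2"
    by (simp add: midpoint_def inner_simps inner_commute field_simps)
  also have "\<dots> = (z - c) \<bullet> (y - x)"
    using eq by (simp add: norm_eq_sqrt_inner)
  finally have inner: "(z - midpoint x y) \<bullet> (y - x) = Re (Z * cnj e)"
    using e by (simp add: inner_eq_Re_to_complex defs)
  have ee: "(y - x) \<bullet> (y - x) = (norm e)\<^sup>2"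
    using e by (metis norm_to_complex power2_norm_eq_inner)
  have "bisector_reflection x y z - c =
      (z - c) - (2 * Re (Z * cnj e) / (norm e)\<^sup>2) *\<^sub>R (y - x)"
    by (simp add: bisector_reflection_def inner ee)
  then have "to_complex (bisector_reflection x y z - c) =
      Z - of_real (2 * Re (Z * cnj e)) / of_real ((norm e)\<^sup>2) * e"
    using e by (simp only: to_complex_diff[of "z - c"] to_complex_scaleR defs of_real_divide)
  also have "complex_of_real (2 * Re (Z * cnj e)) = Z * cnj e + cnj Z * e"
    by (simp add: complex_eq_iff)
  also have "complex_of_real ((norm e)\<^sup>2) = e * cnj e"
    by (simp add: complex_norm_square[symmetric])
  also have "Z - (Z * cnj e + cnj Z * e) / (e * cnj e) * e = - cnj Z * e / cnj e"
    using \<open>e \<noteq> 0\<close> by (simp add: field_simps)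
  also have "\<dots> = X * Y * cnj Z / r\<^sup>2"
  proof -
    have "X \<noteq> 0"
    proof
      assume "X = 0"
      then have "r = 0" using XX by simp
      then have "Y = 0" using YY by simp
      with \<open>X = 0\<close> \<open>e \<noteq> 0\<close> show False by (simp add: e_def)
    qed
    then have "r \<noteq> 0" using XX by auto
    \<comment> \<open>Replacing \<open>X * cnj X\<close> and \<open>Y * cnj Y\<close> by
      \<open>r\<^sup>2\<close> identifies \<open>- e / cnj e\<close> with
      \<open>X * Y / r\<^sup>2\<close>.\<close>
    have "X * Y * cnj e = X * (Y * cnj Y) - Y * (X * cnj X)"
      by (simp add: e_def algebra_simps)
    also have "\<dots> = - (r\<^sup>2 * e)"
      unfolding XX YY by (simp add: e_def algebra_simps)
    finally have *: "X * Y * cnj e = - (r\<^sup>2 * e)" .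
    have "X * Y * cnj Z * cnj e = - (cnj Z * e * r\<^sup>2)"
      using arg_cong[OF *, of "\<lambda>w. w * cnj Z"] by (simp add: algebra_simps)
    then show ?thesis
      using \<open>r \<noteq> 0\<close> \<open>e \<noteq> 0\<close> by (simp add: field_simps)
  qed
  finally show ?thesis
    by (simp add: defs)
qed

subsection \<open>The hexagon of essential fixed points\<close>

text \<open>A barycenter averages over a set, so injectivity keeps points from merging and preserves
  the count.\<close>

lemma barycenter_affine_image:
  assumes "linear f" "inj f" "finite A" "A \<noteq> {}"
  shows "barycenter ((\<lambda>x. f x + k) ` A) = f (barycenter A) + k"
proof -
  have inj: "inj_on (\<lambda>x. f x + k) A"
    using \<open>inj f\<close> by (auto simp: inj_on_def)
  have "(\<Sum>v\<in>(\<lambda>x. f x + k) ` A. v) = f (\<Sum>v\<in>A. v) + real (card A) *\<^sub>R k"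
    using inj \<open>linear f\<close> by (simp add: sum.reindex sum.distrib linear_sum sum_constant_scaleR
        del: sum_constant)
  moreover have "real (card A) \<noteq> 0"
    using assms by simp
  ultimately show ?thesis
    using \<open>linear f\<close> inj
    by (simp add: barycenter_def card_image linear_cmul scaleR_add_right)
qed

lemma barycenter_bisector_reflection:
  assumes "finite A" "A \<noteq> {}"
  shows "barycenter (bisector_reflection x y ` A) = bisector_reflection x y (barycenter A)"
proof -
  have "bisector_reflection x y =
      (\<lambda>z. linear_reflection (y - x) z + bisector_reflection x y 0)"
    using bisector_reflection_affine by blast
  then show ?thesis
    using barycenter_affine_image[OF linear_linear_reflection inj_linear_reflection assms]
    by metis
qed

lemma Psi_affine: "Psi L \<nu> i = (\<lambda>x. (1 / L) *\<^sub>R x + \<nu> i)"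
  by (auto simp: Psi_def divide_inverse)

lemma barycenter_Psi:
  assumes "L > 1" "finite A" "A \<noteq> {}"
  shows "barycenter (Psi L \<nu> i ` A) = Psi L \<nu> i (barycenter A)"
proof -
  have "inj (\<lambda>x::plane. (1 / L) *\<^sub>R x)"
    using \<open>L > 1\<close> by (auto intro: injI)
  then show ?thesis
    unfolding Psi_affine using assms
    by (intro barycenter_affine_image) (auto intro: linear_scaleR linear_scale_self)
qed

text \<open>The circles of radius \<open>r\<close> about \<open>0\<close> and
  \<open>- \<tau>\<close> are distinct, so their common points are roots of a nonzero quadratic.
  This will exclude nonzero translations between six-point sets on one circle.\<close>

lemma card_two_circles_le:
  fixes W :: "complex set"
  assumes "\<And>w. w \<in> W \<Longrightarrow> norm w = r" "\<And>w. w \<in> W \<Longrightarrow> norm (w + \<tau>) = r" "\<tau> \<noteq> 0"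
  shows "card W \<le> 2"
proof -
  \<comment> \<open>Multiplying the equation of the radical line by \<open>w\<close> and using \<open>w * cnj w = r\<^sup>2\<close> removes \<open>cnj w\<close>.\<close>
  have "W \<subseteq> {w. poly [: r\<^sup>2 * \<tau>, \<tau> * cnj \<tau>, cnj \<tau> :] w = 0}"
  proof
    fix w assume "w \<in> W"
    then have "w * cnj w = r\<^sup>2" "(w + \<tau>) * cnj (w + \<tau>) = r\<^sup>2"
      using assms by (metis complex_norm_square of_real_power)+
    then have "w * cnj \<tau> + cnj w * \<tau> + \<tau> * cnj \<tau> = 0"
      by (simp add: algebra_simps)
    then have "w * (w * cnj \<tau> + cnj w * \<tau> + \<tau> * cnj \<tau>) = 0"
      by simp
    then have "w * w * cnj \<tau> + (w * cnj w) * \<tau> + w * \<tau> * cnj \<tau> = 0"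
      by (simp add: algebra_simps)
    then show "w \<in> {w. poly [: r\<^sup>2 * \<tau>, \<tau> * cnj \<tau>, cnj \<tau> :] w = 0}"
      unfolding \<open>w * cnj w = r\<^sup>2\<close> by (simp add: algebra_simps)
  qed
  moreover have nz: "[: r\<^sup>2 * \<tau>, \<tau> * cnj \<tau>, cnj \<tau> :] \<noteq> 0"
    using \<open>\<tau> \<noteq> 0\<close> by simp
  moreover have "degree [: r\<^sup>2 * \<tau>, \<tau> * cnj \<tau>, cnj \<tau> :] = 2"
    using \<open>\<tau> \<noteq> 0\<close> by simp
  ultimately show ?thesis
    using card_poly_roots_bound[OF nz] poly_roots_finite[OF nz] by (metis card_mono le_trans)
qed

lemma primitive_sixth_root:
  obtains \<omega> :: complex where "\<omega> ^ 6 = 1" "\<omega> * \<omega> = \<omega> - 1"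
proof
  \<comment> \<open>This is \<open>exp (\<i> * pi / 3)\<close>, a root of the sixth cyclotomic
    polynomial.\<close>
  let ?w = "Complex (1/2) (sqrt 3 / 2)"
  show *: "?w * ?w = ?w - 1"
    by (simp add: complex_eq_iff field_simps)
  have "?w ^ 6 = (?w * ?w) * (?w * ?w) * (?w * ?w)"
    by (simp add: power_numeral_reduce)
  also have "\<dots> = 1"
    unfolding * by (simp add: complex_eq_iff field_simps)
  finally show "?w ^ 6 = 1" .
qed

text \<open>\<open>x * y / z\<close> is a bisector reflection on a circle about \<open>0\<close>.
  Once \<open>x = y\<close> is covered too, the ratios to a fixed point are sixth roots of unity;
  being six in number, they are all of them.\<close>

lemma six_points_closed_under_reflections:
  fixes W :: "complex set"
  assumes card: "card W = 6" and "0 \<notin> W"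
    and closed: "\<And>x y z. x \<in> W \<Longrightarrow> y \<in> W \<Longrightarrow> z \<in> W \<Longrightarrow> x \<noteq> y \<Longrightarrow> x * y / z \<in> W"
  obtains \<omega> where "\<omega> * \<omega> = \<omega> - 1" "\<And>w. w \<in> W \<Longrightarrow> \<omega> * w \<in> W"
proof -
  have fin: "finite W"
    using card by (intro card_ge_0_finite) simp
  have mult: "z * w / u \<in> W" if "u \<in> W" "z \<in> W" "w \<in> W" for u z w
  proof (cases "z = w")
    case True
    show ?thesis
    proof (cases "z = u")
      case False
      have "card {u, z} \<le> 2"
        by (simp add: card_insert_if)
      then have "\<not> W \<subseteq> {u, z}"
        using card card_mono[of "{u, z}" W] by auto
      then obtain y where y: "y \<in> W" "y \<noteq> u" "y \<noteq> z"
        by blast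
      have nz: "u \<noteq> 0" "z \<noteq> 0" "y \<noteq> 0"
        using that y \<open>0 \<notin> W\<close> by auto
      have "z * y / u \<in> W"
        using closed that y by metis
      moreover have "z * y / u \<noteq> z"
        using nz y by (simp add: field_simps)
      \<comment> \<open>As \<open>z\<close> may not be paired with itself, \<open>z\<^sup>2 / u\<close> is reached through an auxiliary point \<open>y\<close>.\<close>
      ultimately have "(z * y / u) * z / y \<in> W"
        using closed y that by blast
      then show ?thesis
        using nz True by simp
    qed (use True that \<open>0 \<notin> W\<close> in auto)
  qed (use closed that in blast)
  have sixth: "(z / u) ^ 6 = 1" if "u \<in> W" "z \<in> W" for u z
  proof -
    have nz: "z / u \<noteq> 0"
      using that \<open>0 \<notin> W\<close> by auto
    have inj: "inj_on (\<lambda>w. z / u * w) W"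
      using nz by (auto simp: inj_on_def)
    have "(\<lambda>w. z / u * w) ` W \<subseteq> W"
      using mult that by auto
    then have img: "(\<lambda>w. z / u * w) ` W = W"
      using inj fin by (simp add: endo_inj_surj)
    \<comment> \<open>Multiplication by \<open>z / u\<close> permutes \<open>W\<close>, so it
      preserves the product of all six elements.\<close>
    have "\<Prod>W = (\<Prod>w\<in>W. z / u * w)"
      using prod.reindex[OF inj, of id] img by simp
    also have "\<dots> = (z / u) ^ 6 * \<Prod>W"
      by (simp only: prod.distrib prod_constant card)
    finally show ?thesis
      using \<open>0 \<notin> W\<close> fin by simp
  qed
  obtain \<omega> :: complex where \<omega>: "\<omega> ^ 6 = 1" "\<omega> * \<omega> = \<omega> - 1"
    using primitive_sixth_root .
  have "\<omega> * u \<in> W" if "u \<in> W" for u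
  proof -
    have "u \<noteq> 0"
      using that \<open>0 \<notin> W\<close> by auto
    have "(\<lambda>w. w / u) ` W \<subseteq> {z. z ^ 6 = 1}"
      using sixth that by blast
    moreover have "card ((\<lambda>w. w / u) ` W) = 6"
      using \<open>u \<noteq> 0\<close> card by (subst card_image) (auto simp: inj_on_def)
    moreover have "card {z::complex. z ^ 6 = 1} = 6"
      by (rule card_roots_unity_eq) simp
    moreover have "finite {z::complex. z ^ 6 = 1}"
      by (rule finite_roots_unity) simp
    ultimately have "(\<lambda>w. w / u) ` W = {z. z ^ 6 = 1}"
      by (simp add: card_subset_eq)
    then obtain w where "w \<in> W" "\<omega> = w / u"
      using \<omega>(1) by blast
    then show ?thesis
      using \<open>u \<noteq> 0\<close> by simp
  qed
  then show ?thesis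
    using that \<omega>(2) by blast
qed

lemma reflection_symmetryE:
  assumes "reflection_symmetry N L \<nu>" "i \<in> {1..N}"
    "x \<in> essential_fixed_points N L \<nu>" "y \<in> essential_fixed_points N L \<nu>" "x \<noteq> y"
  obtains j where "j \<in> {1..N}"
    "bisector_reflection x y ` Psi L \<nu> i ` essential_fixed_points N L \<nu> =
      Psi L \<nu> j ` essential_fixed_points N L \<nu>"
  using assms by (metis reflection_symmetry_def)

text \<open>
  A reflection \<open>S\<close> permutes the barycenters of the cells, so it fixes their common
  barycenter \<open>c\<close>; hence \<open>V\<close> lies on a circle about \<open>c\<close>. As \<open>S ` V\<close> is a translate of
  \<open>V\<close> on the same circle, \<open>S ` V = V\<close>.
\<close>
lemma essential_fixed_points_hexagon:
  fixes N L \<nu>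
  defines "V \<equiv> essential_fixed_points N L \<nu>"
  defines "b \<equiv> barycenter V"
  assumes L: "L > 1" and card: "card V = 6" and sym: "reflection_symmetry N L \<nu>"
  obtains \<omega> where "\<omega> * \<omega> = \<omega> - 1"
    "\<And>x. x \<in> V \<Longrightarrow> \<exists>y\<in>V. to_complex (y - b) = \<omega> * to_complex (x - b)"
    "\<And>x. x \<in> V \<Longrightarrow> 2 *\<^sub>R b - x \<in> V"
    "\<And>x y. x \<in> V \<Longrightarrow> y \<in> V \<Longrightarrow> norm (x - b) = norm (y - b)"
proof -
  have fin: "finite V" and ne: "V \<noteq> {}"
    using card by (auto intro: card_ge_0_finite)
  then have N: "1 \<in> {1..N}"
    by (auto simp: V_def essential_fixed_points_def fixed_points_def)
  \<comment> \<open>The symmetry condition supplies only some index \<open>j\<close>. On the finite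
    set of centers, inclusion and injectivity give a permutation.\<close>
  define C where "C = (\<lambda>i. Psi L \<nu> i b) ` {1..N}"
  define c where "c = barycenter C"
  have C: "finite C" "C \<noteq> {}"
    using N by (auto simp: C_def)
  have fixed: "bisector_reflection x y c = c" if "x \<in> V" "y \<in> V" "x \<noteq> y" for x y
  proof -
    have "bisector_reflection x y (Psi L \<nu> i b) \<in> C" if i: "i \<in> {1..N}" for i
    proof -
      obtain j where j: "j \<in> {1..N}" "bisector_reflection x y ` Psi L \<nu> i ` V = Psi L \<nu> j ` V"
        using reflection_symmetryE[OF sym i] \<open>x \<in> V\<close> \<open>y \<in> V\<close> \<open>x \<noteq> y\<close>
        unfolding V_def by metis
      have "bisector_reflection x y (Psi L \<nu> i b) = barycenter (bisector_reflection x y ` Psi L \<nu> i ` V)"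
        using fin ne L by (simp add: barycenter_bisector_reflection barycenter_Psi b_def)
      also have "\<dots> = Psi L \<nu> j b"
        using fin ne L by (simp add: j barycenter_Psi b_def)
      finally show ?thesis
        using j by (simp add: C_def)
    qed
    then have "bisector_reflection x y ` C \<subseteq> C"
      by (auto simp: C_def)
    then have "bisector_reflection x y ` C = C"
      using C inj_bisector_reflection by (metis endo_inj_surj inj_on_subset subset_UNIV)
    then show ?thesis
      using barycenter_bisector_reflection[OF C, of x y] by (simp add: c_def)
  qed
  obtain x0 where "x0 \<in> V"
    using ne by blast
  define r where "r = norm (x0 - c)"
  have circle: "norm (x - c) = r" if "x \<in> V" for x
    using bisector_reflection_fixed_imp_equidistant[OF fixed] that \<open>x0 \<in> V\<close>
    unfolding r_def by blast
  have "r \<noteq> 0"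
  proof
    assume "r = 0"
    then have "V \<subseteq> {c}"
      using circle by fastforce
    then have "card V \<le> card {c}"
      by (intro card_mono) auto
    then show False
      using card by simp
  qed
  define W where "W = (\<lambda>x. to_complex (x - c)) ` V"
  have "card W = 6"
    unfolding W_def using card by (subst card_image) (auto intro: inj_onI)
  have norm_W: "norm w = r" if "w \<in> W" for w
    using that circle by (auto simp: W_def)
  have formula: "to_complex (bisector_reflection x y z - c) =
      to_complex (x - c) * to_complex (y - c) / to_complex (z - c)"
    if "x \<in> V" "y \<in> V" "x \<noteq> y" "z \<in> V" for x y z
  proof -
    have "to_complex (z - c) * cnj (to_complex (z - c)) = r\<^sup>2"
      using circle[OF \<open>z \<in> V\<close>] by (metis complex_norm_square norm_to_complex)
    then have "cnj (to_complex (z - c)) = r\<^sup>2 / to_complex (z - c)"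
      using circle[OF \<open>z \<in> V\<close>] \<open>r \<noteq> 0\<close> by (auto simp: field_simps)
    then show ?thesis
      using to_complex_bisector_reflection[of x c y z] that circle \<open>r \<noteq> 0\<close> by simp
  qed
  have invariant: "bisector_reflection x y z \<in> V"
    if xy: "x \<in> V" "y \<in> V" "x \<noteq> y" "z \<in> V" for x y z
  proof -
    let ?S = "bisector_reflection x y" and ?s = "linear_reflection (y - x)"
    obtain j where j: "?S ` Psi L \<nu> 1 ` V = Psi L \<nu> j ` V"
      using reflection_symmetryE[OF sym N] xy unfolding V_def by metis
    \<comment> \<open>Multiplying the equation between the two cells by \<open>L\<close> removes the
      contraction; \<open>\<tau>\<close> collects the constants, so \<open>?S\<close> maps
      \<open>V\<close> onto \<open>V\<close> shifted by \<open>\<tau>\<close>.\<close>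
    define \<tau> where "\<tau> = L *\<^sub>R (\<nu> j - ?s (\<nu> 1) - ?S 0) + ?S 0"
    have shift: "?S u = v + \<tau>" if "?S (Psi L \<nu> 1 u) = Psi L \<nu> j v" for u v
    proof -
      have "(1 / L) *\<^sub>R ?s u + ?s (\<nu> 1) + ?S 0 = (1 / L) *\<^sub>R v + \<nu> j"
        using that bisector_reflection_affine[of x y "Psi L \<nu> 1 u"]
        by (simp add: Psi_affine linear_add[OF linear_linear_reflection]
            linear_cmul[OF linear_linear_reflection])
      then have "(1 / L) *\<^sub>R ?s u = (1 / L) *\<^sub>R v + (\<nu> j - ?s (\<nu> 1) - ?S 0)"
        by (simp add: algebra_simps)
      then have "L *\<^sub>R ((1 / L) *\<^sub>R ?s u) = L *\<^sub>R ((1 / L) *\<^sub>R v + (\<nu> j - ?s (\<nu> 1) - ?S 0))"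
        by simp
      then have "?s u = v + L *\<^sub>R (\<nu> j - ?s (\<nu> 1) - ?S 0)"
        using L by (simp only: scaleR_add_right scaleR_scaleR) simp
      then show ?thesis
        using bisector_reflection_affine[of x y u] by (simp add: \<tau>_def)
    qed
    \<comment> \<open>\<open>v + \<tau>\<close> is a reflected vertex, hence on the circle again.
      All six points of \<open>W\<close> then lie on two circles, which forces
      \<open>\<tau> = 0\<close>.\<close>
    have "norm (w + to_complex \<tau>) = r" if "w \<in> W" for w
    proof -
      obtain v where v: "v \<in> V" "w = to_complex (v - c)"
        using \<open>w \<in> W\<close> by (auto simp: W_def)
      then obtain u where u: "u \<in> V" "?S (Psi L \<nu> 1 u) = Psi L \<nu> j v"
        using j by (metis (no_types, lifting) image_iff)
      have "w + to_complex \<tau> = to_complex (?S u - c)"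
        using shift[OF u(2)] v by (simp add: to_complex_add to_complex_diff)
      then show ?thesis
        using formula[of x y u] \<open>x \<in> V\<close> \<open>y \<in> V\<close> \<open>x \<noteq> y\<close> u circle
        by (simp add: norm_mult norm_divide)
    qed
    then have "to_complex \<tau> = 0"
      using card_two_circles_le[of W r "to_complex \<tau>"] norm_W \<open>card W = 6\<close> by fastforce
    moreover obtain v where v: "v \<in> V" "?S (Psi L \<nu> 1 z) = Psi L \<nu> j v"
      using j \<open>z \<in> V\<close> by blast
    ultimately show ?thesis
      using shift[OF v(2)] by simp
  qed
  have "0 \<notin> W"
    using norm_W \<open>r \<noteq> 0\<close> by fastforce
  moreover have "x * y / z \<in> W" if xyz: "x \<in> W" "y \<in> W" "z \<in> W" and "x \<noteq> y" for x y z
  proof -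
    obtain x' y' z' where "x' \<in> V" "y' \<in> V" "z' \<in> V" "x = to_complex (x' - c)"
      "y = to_complex (y' - c)" "z = to_complex (z' - c)"
      using xyz by (auto simp: W_def)
    then show ?thesis
      using formula[of x' y' z'] invariant[of x' y' z'] \<open>x \<noteq> y\<close>
      by (metis (mono_tags, lifting) W_def image_eqI)
  qed
  ultimately obtain \<omega> where \<omega>: "\<omega> * \<omega> = \<omega> - 1" "\<And>w. w \<in> W \<Longrightarrow> \<omega> * w \<in> W"
    using six_points_closed_under_reflections \<open>card W = 6\<close> by metis
  have rotate: "\<exists>y\<in>V. to_complex (y - c) = \<omega> * to_complex (x - c)" if "x \<in> V" for x
    using \<omega>(2)[of "to_complex (x - c)"] that by (force simp: W_def)
  have "\<omega> * (\<omega> * \<omega>) = - 1"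
    unfolding \<omega>(1) using \<omega>(1) by (simp add: algebra_simps)
  \<comment> \<open>Three turns by \<open>\<omega>\<close> make a half turn about
    \<open>c\<close>.\<close>
  have opposite: "- x + 2 *\<^sub>R c \<in> V" if x: "x \<in> V" for x
  proof -
    have "\<omega> * (\<omega> * (\<omega> * to_complex (x - c))) \<in> W"
      using x by (intro \<omega>(2)) (simp add: W_def)
    moreover have "\<omega> * (\<omega> * (\<omega> * to_complex (x - c))) = \<omega> * (\<omega> * \<omega>) * to_complex (x - c)"
      by (simp only: mult.assoc)
    ultimately have "- to_complex (x - c) \<in> W"
      using \<open>\<omega> * (\<omega> * \<omega>) = - 1\<close> by simp
    then obtain y where y: "y \<in> V" "to_complex (y - c) = - to_complex (x - c)"
      by (auto simp: W_def)
    then have "to_complex (y - c) = to_complex (c - x)"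
      by (simp add: to_complex_diff)
    then have "y = - x + 2 *\<^sub>R c"
      by (simp add: scaleR_2 algebra_simps)
    then show ?thesis
      using y by simp
  qed
  \<comment> \<open>The half turn permutes \<open>V\<close>, so it fixes the barycenter
    \<open>b\<close>; its only fixed point is \<open>c\<close>.\<close>
  have "(\<lambda>x. - x + 2 *\<^sub>R c) ` V = V"
    using opposite fin by (intro endo_inj_surj) (auto intro: inj_onI)
  moreover have "barycenter ((\<lambda>x. - x + 2 *\<^sub>R c) ` V) = - b + 2 *\<^sub>R c"
    unfolding b_def using fin ne
    by (intro barycenter_affine_image) (auto intro: linear_uminus injI)
  ultimately have "b = - b + 2 *\<^sub>R c"
    by (simp add: b_def)
  then have "2 *\<^sub>R b = 2 *\<^sub>R c"
    by (simp add: scaleR_2 algebra_simps)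
  then have "b = c"
    by simp
  then show ?thesis
    using that[OF \<omega>(1)] rotate opposite circle by simp
qed

subsection \<open>Cells of the attractor\<close>

text \<open>The point of \<open>K\<close> nearest to \<open>x\<close> is mapped within
  \<open>K\<close> and strictly nearer, unless its distance is already zero.\<close>

lemma closed_contraction_fixed_point:
  fixes f :: "'a::heine_borel \<Rightarrow> 'a"
  assumes K: "compact K" "K \<noteq> {}" "f ` K \<subseteq> K"
    and contr: "\<And>x y. dist (f x) (f y) \<le> q * dist x y" "q < 1" and "f x = x"
  shows "x \<in> K"
proof -
  obtain p where p: "p \<in> K" "\<And>y. y \<in> K \<Longrightarrow> dist x p \<le> dist x y"
    using distance_attains_inf[of K x] K compact_imp_closed by metis
  have "dist x p \<le> dist x (f p)"
    using p K by blast
  also have "\<dots> \<le> q * dist x p"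
    using contr(1)[of x p] \<open>f x = x\<close> by simp
  finally have "(1 - q) * dist x p \<le> 0"
    by (simp add: algebra_simps)
  then have "dist x p \<le> 0"
    using \<open>q < 1\<close> by (simp add: mult_le_0_iff)
  then show ?thesis
    using p by simp
qed

lemma dist_Psi: "L > 1 \<Longrightarrow> dist (Psi L \<nu> i x) (Psi L \<nu> i y) = dist x y / L"
  by (simp add: Psi_affine dist_norm scaleR_diff_right[symmetric] del: scaleR_diff_right)

lemma fixed_points_subset_attractor:
  assumes "L > 1" "attractor N L \<nu> K"
  shows "fixed_points N L \<nu> \<subseteq> K"
proof
  fix x assume "x \<in> fixed_points N L \<nu>"
  then obtain i where i: "i \<in> {1..N}" "Psi L \<nu> i x = x"
    by (auto simp: fixed_points_def)
  show "x \<in> K"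
  proof (rule closed_contraction_fixed_point[of K "Psi L \<nu> i" "1 / L"])
    show "Psi L \<nu> i ` K \<subseteq> K"
      using assms(2) i unfolding attractor_def by blast
  qed (use assms i in \<open>auto simp: attractor_def dist_Psi\<close>)
qed

text \<open>A finite \<open>K\<close> would have a least positive distance, which any
  \<open>Psi L \<nu> i\<close> shrinks by the factor \<open>L\<close>.\<close>

lemma infinite_attractor:
  assumes "L > 1" "attractor N L \<nu> K" "a \<in> K" "b \<in> K" "a \<noteq> b"
  shows "infinite K"
proof
  assume "finite K"
  obtain i where i: "i \<in> {1..N}"
    using assms(2,3) unfolding attractor_def by blast
  define D where "D = (\<lambda>(x, y). dist x y) ` {(x, y) \<in> K \<times> K. x \<noteq> y}"
  have "finite D" "D \<noteq> {}"
    using \<open>finite K\<close> assms by (auto simp: D_def intro: finite_subset[of _ "K \<times> K"])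
  then have "Min D \<in> D"
    by simp
  then obtain x y where xy: "x \<in> K" "y \<in> K" "x \<noteq> y" "Min D = dist x y"
    by (auto simp: D_def)
  have "Psi L \<nu> i x \<in> K" "Psi L \<nu> i y \<in> K"
    using assms(2) i xy unfolding attractor_def by blast+
  moreover have "Psi L \<nu> i x \<noteq> Psi L \<nu> i y"
    using dist_Psi[OF \<open>L > 1\<close>, of \<nu> i x y] xy \<open>L > 1\<close> by auto
  ultimately have "dist (Psi L \<nu> i x) (Psi L \<nu> i y) \<in> D"
    by (force simp: D_def)
  then have "dist x y \<le> dist x y / L"
    using \<open>finite D\<close> xy dist_Psi[OF \<open>L > 1\<close>] by (metis Min_le)
  then show False
    using xy \<open>L > 1\<close> by (simp add: field_simps)
qed

text \<open>If cell \<open>i\<close> shared no vertex with another cell, nesting would make it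
  disjoint from all others, and a path of the connectivity graph starting in it could never reach
  cell \<open>j\<close>.\<close>

lemma adjacent_cell_exists:
  assumes L: "L > 1" and attr: "attractor N L \<nu> K"
    and nest: "nesting N L \<nu> K" and conn: "connectivity N L \<nu> K"
    and i: "i \<in> {1..N}" and j: "j \<in> {1..N}" "i \<noteq> j"
    and ne: "essential_fixed_points N L \<nu> \<noteq> {}"
  obtains k x y where "k \<in> {1..N}" "k \<noteq> i"
    "x \<in> essential_fixed_points N L \<nu>" "y \<in> essential_fixed_points N L \<nu>"
    "Psi L \<nu> i x = Psi L \<nu> k y"
proof (rule ccontr)
  assume none: "\<not> thesis"
  note shared = that
  let ?V = "essential_fixed_points N L \<nu>"
  have disjoint: "Psi L \<nu> i ` K \<inter> Psi L \<nu> k ` K = {}" if adj: "k \<in> {1..N}" "k \<noteq> i" for k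
  proof -
    have "Psi L \<nu> i ` ?V \<inter> Psi L \<nu> k ` ?V = {}"
      using adj none shared by blast
    then show ?thesis
      using nest i adj unfolding nesting_def by metis
  qed
  define U where "U = (\<Union>i\<in>{1..N}. Psi L \<nu> i ` ?V)"
  define E where "E = {(x, y). x \<in> U \<and> y \<in> U \<and>
      (\<exists>i\<in>{1..N}. x \<in> Psi L \<nu> i ` K \<and> y \<in> Psi L \<nu> i ` K)}"
  obtain v where "v \<in> ?V"
    using ne by blast
  then have "v \<in> K"
    using fixed_points_subset_attractor[OF L attr] by (auto simp: essential_fixed_points_def)
  have "(Psi L \<nu> i v, Psi L \<nu> j v) \<in> E\<^sup>*"
    using conn i j \<open>v \<in> ?V\<close> unfolding connectivity_def Let_def U_def E_def by blast
  then have "Psi L \<nu> j v \<in> Psi L \<nu> i ` K"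
  proof (induction rule: rtrancl_induct)
    case base
    show ?case using \<open>v \<in> K\<close> by blast
  next
    case (step p q)
    then obtain k where k: "k \<in> {1..N}" "p \<in> Psi L \<nu> k ` K" "q \<in> Psi L \<nu> k ` K"
      by (auto simp: E_def)
    then have "k = i"
      using disjoint step.IH by blast
    then show ?case
      using k by simp
  qed
  then show False
    using disjoint[OF j(1)] j(2) \<open>v \<in> K\<close> by blast
qed

lemma scaled_fractal_iff:
  assumes "L > 1"
  shows "p \<in> scaled_fractal L K m \<longleftrightarrow> (1 / L ^ m) *\<^sub>R p \<in> K"
proof
  assume "(1 / L ^ m) *\<^sub>R p \<in> K"
  then have "L ^ m *\<^sub>R ((1 / L ^ m) *\<^sub>R p) \<in> scaled_fractal L K m"
    unfolding scaled_fractal_def by blast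
  then show "p \<in> scaled_fractal L K m"
    using assms by simp
qed (use assms in \<open>auto simp: scaled_fractal_def\<close>)

lemma scale_down_Psi:
  assumes "L > 1"
  shows "(1 / L ^ Suc m) *\<^sub>R (p + L ^ Suc m *\<^sub>R \<nu> i) = Psi L \<nu> i ((1 / L ^ m) *\<^sub>R p)"
  using assms by (simp add: Psi_affine scaleR_add_right)

lemma Psi_attractor:
  "attractor N L \<nu> K \<Longrightarrow> i \<in> {1..N} \<Longrightarrow> x \<in> K \<Longrightarrow> Psi L \<nu> i x \<in> K"
  unfolding attractor_def by blast

lemma scaled_fractal_Suc:
  assumes "L > 1" "attractor N L \<nu> K" "i \<in> {1..N}" "p \<in> scaled_fractal L K m"
  shows "p + L ^ Suc m *\<^sub>R \<nu> i \<in> scaled_fractal L K (Suc m)"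
  using assms Psi_attractor[OF assms(2,3)]
  by (simp only: scaled_fractal_iff scale_down_Psi)

lemma cell_subset_scaled_fractal:
  assumes "L > 1" "attractor N L \<nu> K" "\<forall>j\<in>{1..J}. w j \<in> {1..N}" "x \<in> K"
  shows "(\<Sum>j=1..J. L ^ j *\<^sub>R \<nu> (w j)) + x \<in> scaled_fractal L K J"
  using assms(3)
proof (induction J)
  case 0
  then show ?case
    using assms by (simp add: scaled_fractal_iff)
next
  case (Suc J)
  then have "(\<Sum>j=1..J. L ^ j *\<^sub>R \<nu> (w j)) + x + L ^ Suc J *\<^sub>R \<nu> (w (Suc J))
      \<in> scaled_fractal L K (Suc J)"
    using assms by (intro scaled_fractal_Suc) auto
  then show ?case
    by (simp add: algebra_simps)
qed

text \<open>
  If the outermost map of the address \<open>w\<close> moved the cell out of the copy of \<open>K\<close> that contains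
  the origin, the infinite cell would lie in a finite intersection of two copies.
\<close>
lemma cell_in_first_level:
  assumes L: "L > 1" and attr: "attractor N L \<nu> K" and nest: "nesting N L \<nu> K"
    and "infinite K" and fin: "finite (essential_fixed_points N L \<nu>)"
    and z0: "z0 \<in> {1..N}" "\<nu> z0 = 0"
    and "J \<ge> 1" "\<forall>j\<in>{1..J}. w j \<in> {1..N}"
    and "(+) (\<Sum>j=1..J. L ^ j *\<^sub>R \<nu> (w j)) ` K \<subseteq> scaled_fractal L K 1"
  shows "\<exists>i\<in>{1..N}. (\<Sum>j=1..J. L ^ j *\<^sub>R \<nu> (w j)) = L *\<^sub>R \<nu> i"
  using assms(8-10)
proof (induction J rule: nat_induct_at_least)
  case base
  then show ?case
    by auto
next
  case (Suc J)
  let ?t = "\<Sum>j=1..J. L ^ j *\<^sub>R \<nu> (w j)"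
  let ?t' = "\<Sum>j=1..Suc J. L ^ j *\<^sub>R \<nu> (w j)"
  \<comment> \<open>Rescaling by \<open>L ^ Suc J\<close> turns both copies, the one chosen by the
    last digit and the one containing the origin, into images of \<open>K\<close> under
    \<open>Psi\<close>, where nesting applies.\<close>
  let ?f = "\<lambda>x. (1 / L ^ Suc J) *\<^sub>R (?t' + x)"
  \<comment> \<open>As \<open>\<nu> z0 = 0\<close>, the map with index \<open>z0\<close> is pure
    scaling by \<open>1 / L\<close>, so the complexes increase with the scale.\<close>
  have mono: "scaled_fractal L K 1 \<subseteq> scaled_fractal L K J"
    using Suc.hyps
  proof (induction J rule: nat_induct_at_least)
    case (Suc m)
    then show ?case
      using scaled_fractal_Suc[OF L attr z0(1), of _ m] z0(2) by auto
  qed simp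
  have w: "w (Suc J) \<in> {1..N}"
    using Suc.prems(1) by simp
  have "w (Suc J) = z0"
  proof (rule ccontr)
    assume neq: "w (Suc J) \<noteq> z0"
    have "?f ` K \<subseteq> Psi L \<nu> z0 ` essential_fixed_points N L \<nu>"
    proof (intro image_subsetI)
      fix x assume "x \<in> K"
      have "?t + x \<in> scaled_fractal L K J"
        using Suc.prems(1) \<open>x \<in> K\<close> by (intro cell_subset_scaled_fractal[OF L attr]) auto
      then have "(1 / L ^ J) *\<^sub>R (?t + x) \<in> K"
        using L by (simp only: scaled_fractal_iff)
      moreover have "?f x = Psi L \<nu> (w (Suc J)) ((1 / L ^ J) *\<^sub>R (?t + x))"
        unfolding scale_down_Psi[OF L, symmetric] by (simp add: algebra_simps)
      ultimately have "?f x \<in> Psi L \<nu> (w (Suc J)) ` K"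
        by simp
      moreover have "?f x \<in> Psi L \<nu> z0 ` K"
      proof -
        have "?t' + x \<in> scaled_fractal L K J"
          using Suc.prems(2) mono \<open>x \<in> K\<close> by blast
        then have "(1 / L ^ J) *\<^sub>R (?t' + x) \<in> K"
          using L by (simp only: scaled_fractal_iff)
        moreover have "?f x = Psi L \<nu> z0 ((1 / L ^ J) *\<^sub>R (?t' + x))"
          unfolding scale_down_Psi[OF L, symmetric] using z0(2) by simp
        ultimately show ?thesis
          by simp
      qed
      ultimately show "?f x \<in> Psi L \<nu> z0 ` essential_fixed_points N L \<nu>"
        using nest z0(1) w neq unfolding nesting_def by blast
    qed
    then have "finite (?f ` K)"
      using fin finite_subset by blast
    moreover have "inj_on ?f K"
      using L by (auto intro!: inj_onI)
    ultimately show False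
      using \<open>infinite K\<close> finite_imageD by blast
  qed
  then have eq: "?t' = ?t"
    using z0(2) by simp
  show ?case
    using Suc.IH Suc.prems unfolding eq by simp
qed

lemma first_level_zero_complex_shift:
  assumes "L > 1" "attractor N L \<nu> K" "i \<in> {1..N}"
  shows "L *\<^sub>R \<nu> i \<in> zero_complex_shifts N L \<nu> K"
proof -
  have "(+) (L *\<^sub>R \<nu> i) ` K \<subseteq> scaled_fractal L K 1"
    using cell_subset_scaled_fractal[OF assms(1,2), of 1 "\<lambda>_. i"] assms(3) by auto
  then have "(+) (L *\<^sub>R \<nu> i) ` K \<subseteq> unbounded_fractal L K"
    unfolding unbounded_fractal_def by blast
  moreover have "\<exists>J w. J \<ge> 1 \<and> (\<forall>j\<in>{1..J}. w j \<in> {1..N}) \<and>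
      L *\<^sub>R \<nu> i = (\<Sum>j=1..J. L ^ j *\<^sub>R \<nu> (w j))"
    using assms(3) by (intro exI[of _ 1] exI[of _ "\<lambda>_. i"]) simp
  ultimately show ?thesis
    unfolding zero_complex_shifts_def by blast
qed

subsection \<open>Labellings\<close>

lemma vertex_rotation_to_complex:
  assumes "R \<in> vertex_rotations N L \<nu>"
  obtains q where "q \<noteq> 0"
    "\<And>x. to_complex (R x - barycenter (essential_fixed_points N L \<nu>)) =
      q * to_complex (x - barycenter (essential_fixed_points N L \<nu>))"
proof -
  let ?b = "barycenter (essential_fixed_points N L \<nu>)"
  obtain Q :: "real ^ 2 ^ 2" where Q: "rotation_matrix Q" "R = (\<lambda>x. ?b + Q *v (x - ?b))"
    using assms unfolding vertex_rotations_def Let_def by blast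
  obtain q where "q \<noteq> 0" "\<And>v. to_complex (Q *v v) = q * to_complex v"
    using rotation_matrix_to_complex[OF Q(1)] by blast
  then show ?thesis
    using that[of q] Q(2) by simp
qed

text \<open>At a vertex shared by two cells the two rotated positions carry the same label, and
  labels are injective on the essential fixed points, so the positions agree. Writing each rotation
  as multiplication by \<open>q t\<close> leaves a condition free of labels.\<close>

lemma good_labelling_rotation_factors:
  assumes good: "good_labelling A N L \<nu> K l"
  obtains q where
    "\<And>t. t \<in> zero_complex_shifts N L \<nu> K \<Longrightarrow> q t \<noteq> 0"
    "\<And>t t' x x'. t \<in> zero_complex_shifts N L \<nu> K \<Longrightarrow> t' \<in> zero_complex_shifts N L \<nu> K \<Longrightarrow>
      x \<in> essential_fixed_points N L \<nu> \<Longrightarrow> x' \<in> essential_fixed_points N L \<nu> \<Longrightarrow>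
      t + x = t' + x' \<Longrightarrow>
      q t * to_complex (x - barycenter (essential_fixed_points N L \<nu>)) =
      q t' * to_complex (x' - barycenter (essential_fixed_points N L \<nu>))"
proof -
  let ?V = "essential_fixed_points N L \<nu>" and ?Z = "zero_complex_shifts N L \<nu> K"
  let ?b = "barycenter ?V"
  have "\<forall>t\<in>?Z. \<exists>R\<in>vertex_rotations N L \<nu>. \<forall>v\<in>complex_vertices N L \<nu> t. l v = l (R (v - t))"
    using good by (simp add: good_labelling_def)
  then obtain R where R: "\<And>t. t \<in> ?Z \<Longrightarrow> R t \<in> vertex_rotations N L \<nu>"
    "\<And>t v. t \<in> ?Z \<Longrightarrow> v \<in> complex_vertices N L \<nu> t \<Longrightarrow> l v = l (R t (v - t))"
    by metis
  have "\<forall>t\<in>?Z. \<exists>q. q \<noteq> 0 \<and> (\<forall>x. to_complex (R t x - ?b) = q * to_complex (x - ?b))"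
    using vertex_rotation_to_complex R(1) by metis
  then obtain q where q: "\<And>t. t \<in> ?Z \<Longrightarrow> q t \<noteq> 0"
    "\<And>t x. t \<in> ?Z \<Longrightarrow> to_complex (R t x - ?b) = q t * to_complex (x - ?b)"
    by metis
  have "q t * to_complex (x - ?b) = q t' * to_complex (x' - ?b)"
    if t: "t \<in> ?Z" "t' \<in> ?Z" and x: "x \<in> ?V" "x' \<in> ?V" and eq: "t + x = t' + x'" for t t' x x'
  proof -
    have label: "l (t + x) = l (R t x)" "R t x \<in> ?V" if "t \<in> ?Z" "x \<in> ?V" for t x
      using R(2)[of t "t + x"] R(1)[of t] that
      by (auto simp: complex_vertices_def vertex_rotations_def Let_def)
    have "l (R t x) = l (R t' x')"
      using label(1)[OF t(1) x(1)] label(1)[OF t(2) x(2)] eq by simp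
    moreover have "inj_on l ?V"
      using good by (simp add: good_labelling_def bij_betw_def)
    ultimately have "R t x = R t' x'"
      using label(2) t x by (meson inj_onD)
    then show ?thesis
      using q(2) t by metis
  qed
  then show ?thesis
    using that q(1) by blast
qed

theorem mainTheorem8:
  fixes N :: nat and L :: real and \<nu> :: "nat \<Rightarrow> real ^ 2" and K :: "(real ^ 2) set"
    and A :: "'a set" and t :: "real ^ 2"
  assumes snf: "simple_nested_fractal N L \<nu> K"
    and k6: "card (essential_fixed_points N L \<nu>) = 6"
    and labels: "card A = card (essential_fixed_points N L \<nu>)"
    and cplx: "t \<in> zero_complex_shifts N L \<nu> K" "(+) t ` K \<subseteq> scaled_fractal L K 1"
    and center: "barycenter (complex_vertices N L \<nu> t) =
                 barycenter ((\<lambda>x. L *\<^sub>R x) ` essential_fixed_points N L \<nu>)"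
  shows "\<not> has_GLP A N L \<nu> K"
proof
  assume "has_GLP A N L \<nu> K"
  then obtain l where good: "good_labelling A N L \<nu> K l"
    by (auto simp: has_GLP_def)
  let ?Z = "zero_complex_shifts N L \<nu> K"
  define V where "V = essential_fixed_points N L \<nu>"
  define b where "b = barycenter V"
  have L: "L > 1" and attr: "attractor N L \<nu> K" and nest: "nesting N L \<nu> K"
    and osc: "open_set_condition N L \<nu>"
    and sym: "reflection_symmetry N L \<nu>" and conn: "connectivity N L \<nu> K"
    using snf by (auto simp: simple_nested_fractal_def)
  obtain z0 where z0: "z0 \<in> {1..N}" "\<nu> z0 = 0"
    using snf by (auto simp: simple_nested_fractal_def)
  have V: "finite V" "V \<noteq> {}"
    using k6 unfolding V_def by (auto intro: card_ge_0_finite)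

  \<comment> \<open>Distinct cells and an infinite attractor\<close>
  obtain a a' where a: "a \<in> V" "a' \<in> V" "a \<noteq> a'"
    using card_le_Suc0_iff_eq[OF V(1)] k6 unfolding V_def by auto
  obtain i0 i1 where i01: "i0 \<in> {1..N}" "i1 \<in> {1..N}" "Psi L \<nu> i0 a = a" "Psi L \<nu> i1 a' = a'"
    using a by (auto simp: V_def essential_fixed_points_def fixed_points_def)
  \<comment> \<open>A contraction has only one fixed point.\<close>
  have "i0 \<noteq> i1"
  proof
    assume "i0 = i1"
    then have "dist a a' = dist a a' / L"
      using dist_Psi[OF L, of \<nu> i0 a a'] i01 by simp
    then show False
      using L \<open>a \<noteq> a'\<close> by (simp add: field_simps)
  qed
  have "V \<subseteq> K"
    using fixed_points_subset_attractor[OF L attr] unfolding V_def essential_fixed_points_def by blast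
  then have "infinite K"
    using infinite_attractor[OF L attr _ _ a(3)] a by blast

  have nu_inj: "\<nu> i \<noteq> \<nu> j" if ij: "i \<in> {1..N}" "j \<in> {1..N}" "i \<noteq> j" for i j
  proof
    assume "\<nu> i = \<nu> j"
    then have "Psi L \<nu> i = Psi L \<nu> j"
      by (simp add: Psi_affine)
    moreover obtain U where "U \<noteq> {}" "Psi L \<nu> i ` U \<inter> Psi L \<nu> j ` U = {}"
      using osc ij unfolding open_set_condition_def by blast
    ultimately show False
      by simp
  qed

  \<comment> \<open>The hexagon and the rotation factors\<close>
  obtain \<omega> where \<omega>: "\<omega> * \<omega> = \<omega> - 1"
    and rot: "\<And>x. x \<in> V \<Longrightarrow> \<exists>y\<in>V. to_complex (y - b) = \<omega> * to_complex (x - b)"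
    and opp: "\<And>x. x \<in> V \<Longrightarrow> 2 *\<^sub>R b - x \<in> V"
    and norm: "\<And>x y. x \<in> V \<Longrightarrow> y \<in> V \<Longrightarrow> norm (x - b) = norm (y - b)"
    using essential_fixed_points_hexagon[OF L k6 sym] unfolding b_def V_def by blast
  have "\<omega> \<noteq> 0" "\<omega> \<noteq> 1"
    using \<omega> by auto

  obtain q where q: "\<And>t. t \<in> ?Z \<Longrightarrow> q t \<noteq> 0"
    and q_eq: "\<And>t t' x x'. t \<in> ?Z \<Longrightarrow> t' \<in> ?Z \<Longrightarrow> x \<in> V \<Longrightarrow> x' \<in> V \<Longrightarrow> t + x = t' + x' \<Longrightarrow>
      q t * to_complex (x - b) = q t' * to_complex (x' - b)"
    using good_labelling_rotation_factors[OF good] unfolding b_def V_def by blast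
  \<comment> \<open>The two cells meet at vertex \<open>x\<close> of the first, which is the
    opposite vertex of the second; there the factors multiply opposite vectors.\<close>
  have q_opp: "q t' = - q t"
    if "t \<in> ?Z" "t' \<in> ?Z" "x \<in> V" "x \<noteq> b" "t' - t = 2 *\<^sub>R (x - b)" for t t' x
  proof -
    have "t + x = t' + (2 *\<^sub>R b - x)"
      using that(5) by (simp add: scaleR_2 algebra_simps)
    then have "q t * to_complex (x - b) = q t' * to_complex (2 *\<^sub>R b - x - b)"
      using q_eq that opp by blast
    also have "\<dots> = - (q t' * to_complex (x - b))"
      by (simp add: to_complex_point_reflection)
    finally have "(q t + q t') * to_complex (x - b) = 0"
      by (simp add: algebra_simps)
    then show ?thesis
      using \<open>x \<noteq> b\<close> by (simp add: add_eq_0_iff)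
  qed

  obtain i where i: "i \<in> {1..N}" "t = L *\<^sub>R \<nu> i"
  proof -
    obtain J w where "J \<ge> 1" "\<forall>j\<in>{1..J}. w j \<in> {1..N}" "t = (\<Sum>j=1..J. L ^ j *\<^sub>R \<nu> (w j))"
      using cplx(1) by (auto simp: zero_complex_shifts_def)
    then show ?thesis
      using that cell_in_first_level[OF L attr nest \<open>infinite K\<close> _ z0, of J w] V(1) cplx(2)
      unfolding V_def by blast
  qed
  \<comment> \<open>The two barycenters in \<open>center\<close> are the images of \<open>b\<close>
    under translation by \<open>t\<close> and scaling by \<open>L\<close>.\<close>
  have "t + b = L *\<^sub>R b"
  proof -
    have "barycenter (complex_vertices N L \<nu> t) = barycenter ((\<lambda>x. id x + t) ` V)"
      by (simp add: complex_vertices_def V_def add.commute)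
    also have "\<dots> = id b + t"
      unfolding b_def using V by (intro barycenter_affine_image) (auto simp: linear_ident)
    finally have "barycenter (complex_vertices N L \<nu> t) = t + b"
      by (simp add: add.commute)
    moreover have "barycenter ((\<lambda>x. L *\<^sub>R x + 0) ` V) = L *\<^sub>R b + 0"
      unfolding b_def using V L
      by (intro barycenter_affine_image) (auto intro: linear_scale_self injI)
    ultimately show ?thesis
      using center by (simp add: V_def)
  qed

  \<comment> \<open>A neighbour of the central cell\<close>
  have "\<exists>j\<in>{1..N}. i \<noteq> j"
    using i01 \<open>i0 \<noteq> i1\<close> by metis
  then obtain j x y where j: "j \<in> {1..N}" "j \<noteq> i" and xy: "x \<in> V" "y \<in> V"
    "Psi L \<nu> i x = Psi L \<nu> j y"
    using adjacent_cell_exists[OF L attr nest conn i(1)] V(2) unfolding V_def by metis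
  define t1 where "t1 = L *\<^sub>R \<nu> j"
  have Z: "t \<in> ?Z" "t1 \<in> ?Z"
    using cplx(1) first_level_zero_complex_shift[OF L attr j(1)] by (simp_all add: t1_def)
  have "L *\<^sub>R Psi L \<nu> i x = L *\<^sub>R Psi L \<nu> j y"
    using xy by simp
  then have meet: "t + x = t1 + y"
    using L by (simp add: Psi_affine i(2) t1_def scaleR_add_right algebra_simps)
  have "t \<noteq> t1"
    using nu_inj[OF i(1) j(1)] j(2) L by (simp add: i(2) t1_def)
  then have "x \<noteq> y"
    using meet by auto
  define X Y where "X = to_complex (x - b)" and "Y = to_complex (y - b)"
  have "X \<noteq> Y"
    using \<open>x \<noteq> y\<close> by (simp add: X_def Y_def)
  \<comment> \<open>A vertex at the center would give the circle radius zero and make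
    \<open>x = y\<close>.\<close>
  have "x \<noteq> b"
    using norm[OF xy(1,2)] \<open>x \<noteq> y\<close> by auto
  then have "X \<noteq> 0"
    by (simp add: X_def)

  text \<open>
    The opposite vertices of \<open>x\<close> and \<open>y\<close> are common to the two cells as well, which forces
    \<open>Y\<^sup>2 = X\<^sup>2\<close>.
  \<close>
  have "Y = - X"
  proof -
    have 1: "q t * X = q t1 * Y"
      unfolding X_def Y_def using q_eq Z xy meet by blast
    have "t + (2 *\<^sub>R b - y) = t1 + (2 *\<^sub>R b - x)"
      using meet by (simp add: algebra_simps)
    then have "q t * to_complex (2 *\<^sub>R b - y - b) = q t1 * to_complex (2 *\<^sub>R b - x - b)"
      using q_eq Z xy opp by blast
    then have 2: "q t * Y = q t1 * X"
      by (simp add: X_def Y_def to_complex_point_reflection)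
    have "q t * (X * X) = (q t1 * Y) * X"
      using 1 by (metis mult.assoc)
    also have "\<dots> = (q t1 * X) * Y"
      by (simp add: ac_simps)
    also have "\<dots> = q t * (Y * Y)"
      using 2 by (metis mult.assoc)
    finally have "X * X = Y * Y"
      using q[OF Z(1)] by simp
    then show ?thesis
      using \<open>X \<noteq> Y\<close> by (metis minus_minus square_eq_iff)
  qed
  have "to_complex (t1 - t) = X - Y"
    using arg_cong[OF meet, of to_complex]
    by (simp add: X_def Y_def to_complex_add to_complex_diff algebra_simps)
  then have "to_complex (t1 - t) = 2 * X"
    by (simp add: \<open>Y = - X\<close>)
  then have t1: "t1 - t = 2 *\<^sub>R (x - b)"
    unfolding to_complex_eq_iff[symmetric] by (simp add: X_def to_complex_scaleR)

  \<comment> \<open>A third cell by reflection\<close>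
  obtain z where z: "z \<in> V" "to_complex (z - b) = \<omega> * X"
    using rot[OF xy(1)] by (auto simp: X_def)
  \<comment> \<open>\<open>z\<close> is the direction from \<open>t\<close> to the third cell,
    \<open>u\<close> the one from \<open>t1\<close> to it.\<close>
  obtain u where u: "u \<in> V" "to_complex (u - b) = \<omega> * (\<omega> * X)"
    using rot[OF z(1)] z(2) by auto
  have "z \<noteq> b" "u \<noteq> b"
    using z(2) u(2) \<open>\<omega> \<noteq> 0\<close> \<open>X \<noteq> 0\<close> by auto
  have "x \<noteq> z"
    using z(2) \<open>\<omega> \<noteq> 1\<close> \<open>X \<noteq> 0\<close> by (auto simp: X_def)
  \<comment> \<open>The reflection exchanging \<open>x\<close> and \<open>z\<close> turns direction
    \<open>X\<close> into \<open>\<omega> * X\<close>, hence carries the neighbour \<open>t1\<close>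
    to the cell wanted.\<close>
  obtain k where k: "k \<in> {1..N}" "bisector_reflection x z ` Psi L \<nu> j ` V = Psi L \<nu> k ` V"
    using reflection_symmetryE[OF sym j(1)] xy(1) z(1) \<open>x \<noteq> z\<close> unfolding V_def by metis
  define t2 where "t2 = L *\<^sub>R \<nu> k"
  have Z2: "t2 \<in> ?Z"
    using first_level_zero_complex_shift[OF L attr k(1)] by (simp add: t2_def)
  have "to_complex (t2 - t) = 2 * (\<omega> * X)"
  proof -
    \<comment> \<open>Because the cell \<open>t\<close> is central, reflections about
      \<open>b\<close> act, after scaling by \<open>L\<close>, on shifts relative to
      \<open>t\<close>.\<close>
    have "L *\<^sub>R (Psi L \<nu> m b - b) = L *\<^sub>R \<nu> m - t" for m
      using L \<open>t + b = L *\<^sub>R b\<close> by (simp add: Psi_affine algebra_simps)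
    then have centre: "L * to_complex (Psi L \<nu> m b - b) = to_complex (L *\<^sub>R \<nu> m - t)" for m
      by (metis to_complex_scaleR)
    have "Psi L \<nu> k b = barycenter (bisector_reflection x z ` Psi L \<nu> j ` V)"
      unfolding k(2) using L V by (simp add: barycenter_Psi b_def)
    also have "\<dots> = bisector_reflection x z (Psi L \<nu> j b)"
      using L V by (simp add: barycenter_bisector_reflection barycenter_Psi b_def)
    finally have "to_complex (t2 - t) = L * to_complex (bisector_reflection x z (Psi L \<nu> j b) - b)"
      using centre[of k] by (simp add: t2_def)
    also have "\<dots> = X * (\<omega> * X) * cnj (L * to_complex (Psi L \<nu> j b - b)) / (norm (x - b))\<^sup>2"
      using to_complex_bisector_reflection[OF norm[OF xy(1) z(1)] \<open>x \<noteq> z\<close>, of "Psi L \<nu> j b"] z(2)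
      by (simp add: X_def)
    also have "L * to_complex (Psi L \<nu> j b - b) = 2 * X"
      using centre[of j] \<open>to_complex (t1 - t) = 2 * X\<close> by (simp add: t1_def)
    also have "complex_of_real ((norm (x - b))\<^sup>2) = X * cnj X"
      unfolding X_def by (metis complex_norm_square norm_to_complex of_real_power)
    finally show ?thesis
      using \<open>X \<noteq> 0\<close> by simp
  qed
  then have t2: "t2 - t = 2 *\<^sub>R (z - b)"
    unfolding to_complex_eq_iff[symmetric] by (simp add: z(2) to_complex_scaleR)
  have "to_complex (t2 - t1) = to_complex (t2 - t) - to_complex (t1 - t)"
    by (simp add: to_complex_diff)
  \<comment> \<open>Since \<open>\<omega> - 1 = \<omega> * \<omega>\<close>, this difference is
    again twice a vertex vector.\<close>
  also have "\<dots> = 2 * ((\<omega> - 1) * X)"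
    using \<open>to_complex (t2 - t) = 2 * (\<omega> * X)\<close> \<open>to_complex (t1 - t) = 2 * X\<close>
    by (simp add: algebra_simps)
  also have "\<dots> = to_complex (2 *\<^sub>R (u - b))"
    by (simp add: u(2) to_complex_scaleR flip: \<omega>)
  finally have t12: "t2 - t1 = 2 *\<^sub>R (u - b)"
    by simp

  text \<open>The pairwise touching cells \<open>t\<close>, \<open>t1\<close>, \<open>t2\<close> form an odd cycle of sign changes.\<close>
  have "q t1 = - q t" "q t2 = - q t" "q t2 = - q t1"
    using q_opp t1 t2 t12 Z Z2 xy(1) z(1) u(1) \<open>x \<noteq> b\<close> \<open>z \<noteq> b\<close> \<open>u \<noteq> b\<close> by blast+
  then show False
    using q[OF Z(1)] by simp
qed

end
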